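(* Let $\alpha\in\mathbb{R}$ and let $\Phi\colon\mathbb{L}^2\to\mathbb{L}^2$, $\Phi(x,y)=(y,x)$. If $\gamma$ is an $\alpha$-stationary spacelike curve contained in $\mathcal{C}^-$ (resp. $\mathcal{C}^+$), then $\widetilde{\gamma}=\Phi\circ\gamma$ is an $\alpha$-stationary timelike curve contained in $\mathcal{C}^+$ (resp. $\mathcal{C}^-$).
   Context: $\mathbb{L}^2=(\mathbb{R}^2,\langle\cdot,\cdot\rangle)$ with $\langle\cdot,\cdot\rangle=dx^2-dy^2$. $\mathcal{C}=\{p\in\mathbb{L}^2:\langle p,p\rangle=0\}$ is the lightlike cone, $\mathcal{C}^-=\{p:\langle p,p\rangle<0\}$, $\mathcal{C}^+=\{p:\langle p,p\rangle>0\}$. A smooth regular curve is spacelike (resp. timelike) if $\langle\gamma',\gamma'\rangle>0$ (resp. $<0$) everywhere. Let $N$ be a unit normal field along $\gamma$ ($\langle N,\gamma'\rangle=0$, $|\langle N,N\rangle|=1$). When $\gamma$ is parametrized by arc-length ($|\langle\gamma',\gamma'\rangle|=1$) its curvature is $\kappa=-\langle N,\gamma''\rangle$. A spacelike or timelike curve $\gamma\colon I\to\mathbb{L}^2$ with $\gamma(I)\cap\mathcal{C}=\emptyset$ is called $\alpha$-stationary if $\kappa=-\alpha\,\dfrac{\langle N,\gamma\rangle}{|\langle\gamma,\gamma\rangle|}$ along $\gamma$ (this condition does not depend on the choice of sign of $N$). *)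

theory Defs
  imports "HOL-Analysis.Analysis"
begin

type_synonym L2 = "real \<times> real"

definition lorentz :: "L2 \<Rightarrow> L2 \<Rightarrow> real" where
  "lorentz p q = fst p * fst q - snd p * snd q"

definition light_cone :: "L2 set" where
  "light_cone = {p. lorentz p p = 0}"

definition cone_minus :: "L2 set" where
  "cone_minus = {p. lorentz p p < 0}"

definition cone_plus :: "L2 set" where
  "cone_plus = {p. lorentz p p > 0}"

definition Phi :: "L2 \<Rightarrow> L2" where
  "Phi = (\<lambda>(x, y). (y, x))"

definition nondegenerate_interval :: "real set \<Rightarrow> bool" where
  "nondegenerate_interval I \<longleftrightarrow> is_interval I \<and> interior I \<noteq> {}"

(* Derivatives are taken within I: they are the ordinary ones at interior points and the
   one-sided ones at an end point belonging to I. *)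
primrec vderiv :: "real set \<Rightarrow> nat \<Rightarrow> (real \<Rightarrow> 'a::real_normed_vector) \<Rightarrow> real \<Rightarrow> 'a" where
  "vderiv I 0 f = f"
| "vderiv I (Suc n) f = (\<lambda>t. vector_derivative (vderiv I n f) (at t within I))"

definition smooth_on :: "real set \<Rightarrow> (real \<Rightarrow> 'a::real_normed_vector) \<Rightarrow> bool" where
  "smooth_on I f \<longleftrightarrow> (\<forall>n. vderiv I n f differentiable_on I)"

definition regular_curve :: "real set \<Rightarrow> (real \<Rightarrow> L2) \<Rightarrow> bool" where
  "regular_curve I \<gamma> \<longleftrightarrow>
     nondegenerate_interval I \<and> smooth_on I \<gamma> \<and> (\<forall>t\<in>I. vderiv I 1 \<gamma> t \<noteq> 0)"

definition spacelike_curve :: "real set \<Rightarrow> (real \<Rightarrow> L2) \<Rightarrow> bool" where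
  "spacelike_curve I \<gamma> \<longleftrightarrow>
     regular_curve I \<gamma> \<and> (\<forall>t\<in>I. lorentz (vderiv I 1 \<gamma> t) (vderiv I 1 \<gamma> t) > 0)"

definition timelike_curve :: "real set \<Rightarrow> (real \<Rightarrow> L2) \<Rightarrow> bool" where
  "timelike_curve I \<gamma> \<longleftrightarrow>
     regular_curve I \<gamma> \<and> (\<forall>t\<in>I. lorentz (vderiv I 1 \<gamma> t) (vderiv I 1 \<gamma> t) < 0)"

definition unit_normal_field :: "real set \<Rightarrow> (real \<Rightarrow> L2) \<Rightarrow> (real \<Rightarrow> L2) \<Rightarrow> bool" where
  "unit_normal_field I \<gamma> N \<longleftrightarrow>
     smooth_on I N \<and>
     (\<forall>t\<in>I. lorentz (N t) (vderiv I 1 \<gamma> t) = 0 \<and> \<bar>lorentz (N t) (N t)\<bar> = 1)"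

definition arclength_parametrized :: "real set \<Rightarrow> (real \<Rightarrow> L2) \<Rightarrow> bool" where
  "arclength_parametrized I \<gamma> \<longleftrightarrow>
     (\<forall>t\<in>I. \<bar>lorentz (vderiv I 1 \<gamma> t) (vderiv I 1 \<gamma> t)\<bar> = 1)"

(* Meaningful only for curves parametrized by arc-length. *)
definition curvature :: "real set \<Rightarrow> (real \<Rightarrow> L2) \<Rightarrow> (real \<Rightarrow> L2) \<Rightarrow> real \<Rightarrow> real" where
  "curvature I \<gamma> N t = - lorentz (N t) (vderiv I 2 \<gamma> t)"

definition change_of_parameter :: "real set \<Rightarrow> real set \<Rightarrow> (real \<Rightarrow> real) \<Rightarrow> bool" where
  "change_of_parameter J I \<phi> \<longleftrightarrow>
     nondegenerate_interval J \<and> bij_betw \<phi> J I \<and> smooth_on J \<phi> \<and>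
     (\<forall>s\<in>J. vderiv J 1 \<phi> s \<noteq> 0)"

(* The curvature of a curve with arbitrary parameter is that of an arc-length
   reparametrization; the existentials are harmless because every spacelike or timelike
   curve has such a reparametrization and a smooth unit normal, and the equation
   does not depend on the choice of either. *)
definition stationary_curve :: "real \<Rightarrow> real set \<Rightarrow> (real \<Rightarrow> L2) \<Rightarrow> bool" where
  "stationary_curve \<alpha> I \<gamma> \<longleftrightarrow>
     (spacelike_curve I \<gamma> \<or> timelike_curve I \<gamma>) \<and> \<gamma> ` I \<inter> light_cone = {} \<and>
     (\<exists>J \<phi> N.
        change_of_parameter J I \<phi> \<and> arclength_parametrized J (\<gamma> \<circ> \<phi>) \<and>
        unit_normal_field J (\<gamma> \<circ> \<phi>) N \<and>
        (\<forall>s\<in>J. curvature J (\<gamma> \<circ> \<phi>) N s =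
           - \<alpha> * (lorentz (N s) ((\<gamma> \<circ> \<phi>) s) / \<bar>lorentz ((\<gamma> \<circ> \<phi>) s) ((\<gamma> \<circ> \<phi>) s)\<bar>)))"

end

theory Submission imports Defs begin

text \<open>
  The swap \<open>Phi\<close> is a linear involution and an anti-isometry of the Lorentzian plane: it reverses
  the sign of every product \<open>lorentz p q\<close>. Being linear, it commutes with differentiation, so along
  the swapped curve every quantity that enters the definition of a stationary curve is a product of
  swapped vectors, and merely changes sign. Hence the causal characters of velocity and position are
  interchanged, while absolute values survive: arc-length parameters remain arc-length parameters
  and the swapped normal is again a unit normal. In the equation
  \<open>\<kappa> = - \<alpha> * (lorentz N \<gamma> / \<bar>lorentz \<gamma> \<gamma>\<bar>)\<close> both sides change sign, so the equation is preserved
  with the same \<open>\<alpha>\<close>.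

  The one analytic point is that the derivatives occurring here must exist before they can be
  interchanged with \<open>Phi\<close>. For an arc-length reparametrization \<open>\<gamma> \<circ> \<phi>\<close> this is needed up to second
  order and comes from the chain and product rules.
\<close>

lemma nondegenerate_interval_islimpt:
  assumes "nondegenerate_interval I" "t \<in> I"
  shows "t islimpt I"
proof (rule connected_imp_perfect)
  show "connected I" "t \<in> I"
    using assms is_interval_connected unfolding nondegenerate_interval_def by auto
  have "interior {x} = {}" for x :: real by simp
  then show "I \<noteq> {x}" for x
    using assms(1) unfolding nondegenerate_interval_def by metis
qed

text \<open>A derivative within a set is unique at the limit points of that set, and every point of a
  nondegenerate interval, end points included, is one.\<close>

lemma vector_derivative_within_interval:
  assumes "nondegenerate_interval I" "t \<in> I" "(f has_vector_derivative v) (at t within I)"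
  shows "vector_derivative f (at t within I) = v"
  using assms nondegenerate_interval_islimpt
  by (intro vector_derivative_within) (auto simp: trivial_limit_within)

lemma has_vector_derivative_vderiv_Suc:
  assumes "vderiv I n f differentiable_on I" "t \<in> I"
  shows "(vderiv I n f has_vector_derivative vderiv I (Suc n) f t) (at t within I)"
  using assms by (simp add: differentiable_on_def vector_derivative_works[symmetric])

text \<open>The equality is available only on \<open>I\<close>, where the derivatives are determined; that suffices for
  the induction, since a derivative within \<open>I\<close> depends only on values on \<open>I\<close>. Differentiability is
  asked for below order \<open>n\<close> only, so that curves known to be finitely often differentiable
  qualify.\<close>

lemma vderiv_bounded_linear:
  assumes L: "bounded_linear L" and I: "nondegenerate_interval I"
    and "\<And>k. k < n \<Longrightarrow> vderiv I k f differentiable_on I" and "t \<in> I"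
  shows "vderiv I n (L \<circ> f) t = L (vderiv I n f t)"
  using assms(3,4)
proof (induction n arbitrary: t)
  case 0
  then show ?case by simp
next
  case (Suc n)
  have "((\<lambda>s. L (vderiv I n f s)) has_vector_derivative L (vderiv I (Suc n) f t)) (at t within I)"
    using Suc.prems
    by (intro bounded_linear.has_vector_derivative[OF L] has_vector_derivative_vderiv_Suc) auto
  then have "(vderiv I n (L \<circ> f) has_vector_derivative L (vderiv I (Suc n) f t)) (at t within I)"
  proof (rule has_vector_derivative_transform[rotated 2])
    show "vderiv I n (L \<circ> f) s = L (vderiv I n f s)" if "s \<in> I" for s
      using Suc.IH Suc.prems(1) that less_Suc_eq by blast
  qed (rule Suc.prems(2))
  from vector_derivative_within_interval[OF I Suc.prems(2) this] show ?case
    by (simp add: o_def)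
qed

lemma smooth_on_bounded_linear:
  assumes L: "bounded_linear L" and I: "nondegenerate_interval I" and "smooth_on I f"
  shows "smooth_on I (L \<circ> f)"
  unfolding smooth_on_def
proof
  fix n
  have f: "vderiv I k f differentiable_on I" for k
    using assms(3) by (simp add: smooth_on_def)
  have "(\<lambda>t. L (vderiv I n f t)) differentiable_on I"
    using bounded_linear.has_vector_derivative[OF L has_vector_derivative_vderiv_Suc[OF f]]
    unfolding differentiable_on_def by (blast intro: differentiableI_vector)
  then show "vderiv I n (L \<circ> f) differentiable_on I"
    using vderiv_bounded_linear[OF L I f]
    unfolding differentiable_on_def
    by (metis differentiable_transform_within zero_less_one)
qed

lemma vderiv_compose_parameter:
  assumes J: "nondegenerate_interval J" and im: "\<phi> ` J \<subseteq> I"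
    and \<phi>: "\<phi> differentiable_on J" and f: "f differentiable_on I" and s: "s \<in> J"
  shows "(f \<circ> \<phi> has_vector_derivative vderiv J 1 \<phi> s *\<^sub>R vderiv I 1 f (\<phi> s)) (at s within J)"
    and "vderiv J 1 (f \<circ> \<phi>) s = vderiv J 1 \<phi> s *\<^sub>R vderiv I 1 f (\<phi> s)"
proof -
  have "(f has_vector_derivative vderiv I 1 f (\<phi> s)) (at (\<phi> s) within I)"
    using has_vector_derivative_vderiv_Suc[of I 0 f] f s im by auto
  then have "(f has_vector_derivative vderiv I 1 f (\<phi> s)) (at (\<phi> s) within \<phi> ` J)"
    using im has_vector_derivative_within_subset by blast
  then show *: "(f \<circ> \<phi> has_vector_derivative vderiv J 1 \<phi> s *\<^sub>R vderiv I 1 f (\<phi> s)) (at s within J)"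
    using has_vector_derivative_vderiv_Suc[of J 0 \<phi> s] \<phi> s
    by (intro vector_diff_chain_within) auto
  show "vderiv J 1 (f \<circ> \<phi>) s = vderiv J 1 \<phi> s *\<^sub>R vderiv I 1 f (\<phi> s)"
    using vector_derivative_within_interval[OF J s *] by simp
qed

text \<open>The curvature involves derivatives up to order two, so it is enough to know that a
  reparametrized smooth curve and its first derivative are differentiable. The first derivative is
  \<open>\<phi>'\<close> times a reparametrization of the curve's derivative, to which the chain rule applies again.\<close>

lemma twice_differentiable_compose_parameter:
  assumes J: "nondegenerate_interval J" and im: "\<phi> ` J \<subseteq> I"
    and \<phi>: "smooth_on J \<phi>" and f: "smooth_on I f" and "k < 2"
  shows "vderiv J k (f \<circ> \<phi>) differentiable_on J"
proof -
  have d\<phi>: "vderiv J k \<phi> differentiable_on J" and df: "vderiv I k f differentiable_on I" for k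
    using \<phi> f by (simp_all add: smooth_on_def)
  note d0 = d\<phi>[of 0, simplified vderiv.simps(1)]
  have comp: "g \<circ> \<phi> differentiable_on J" if "g differentiable_on I" for g :: "real \<Rightarrow> 'a"
    using vderiv_compose_parameter(1)[OF J im d0 that]
    unfolding differentiable_on_def by (blast intro: differentiableI_vector)
  have "(\<lambda>s. vderiv J 1 \<phi> s *\<^sub>R (vderiv I 1 f \<circ> \<phi>) s) differentiable_on J"
    using d\<phi>[of 1] comp[OF df[of 1]] unfolding differentiable_on_def
    by (blast intro: differentiable_scaleR)
  then have "vderiv J 1 (f \<circ> \<phi>) differentiable_on J"
    using vderiv_compose_parameter(2)[OF J im d0, of f] df[of 0] unfolding differentiable_on_def
    by (force intro: differentiable_transform_within[OF _ zero_less_one])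
  moreover have "vderiv J 0 (f \<circ> \<phi>) differentiable_on J"
    using comp[OF df[of 0]] by simp
  ultimately show ?thesis
    using \<open>k < 2\<close> by (cases k) (auto simp: less_Suc_eq numeral_2_eq_2)
qed

lemma lorentz_Phi: "lorentz (Phi p) (Phi q) = - lorentz p q"
  by (simp add: lorentz_def Phi_def case_prod_beta)

lemma bounded_linear_Phi: "bounded_linear Phi"
  unfolding Phi_def case_prod_beta
  by (intro bounded_linear_Pair bounded_linear_fst bounded_linear_snd)

lemma Phi_eq_0_iff: "Phi p = 0 \<longleftrightarrow> p = 0"
  by (cases p) (auto simp: Phi_def zero_prod_def)

lemma vderiv_1_Phi:
  assumes "nondegenerate_interval I" "f differentiable_on I" "t \<in> I"
  shows "vderiv I 1 (Phi \<circ> f) t = Phi (vderiv I 1 f t)"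
  using assms by (intro vderiv_bounded_linear bounded_linear_Phi) auto

lemma timelike_curve_Phi:
  assumes "spacelike_curve I \<gamma>"
  shows "timelike_curve I (Phi \<circ> \<gamma>)"
proof -
  have I: "nondegenerate_interval I" and sm: "smooth_on I \<gamma>"
    using assms by (simp_all add: spacelike_curve_def regular_curve_def)
  have "vderiv I 0 \<gamma> differentiable_on I"
    using sm unfolding smooth_on_def by blast
  then have "vderiv I 1 (Phi \<circ> \<gamma>) t = Phi (vderiv I 1 \<gamma> t)" if "t \<in> I" for t
    using vderiv_1_Phi[OF I _ that] by simp
  then show ?thesis
    using assms smooth_on_bounded_linear[OF bounded_linear_Phi I sm]
    by (simp add: spacelike_curve_def timelike_curve_def regular_curve_def
        lorentz_Phi Phi_eq_0_iff del: One_nat_def)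
qed

text \<open>The parameter change that makes the given curve unit speed also serves the swapped curve, with
  the swapped normal; the two signs picked up by the stationarity equation cancel.\<close>

lemma stationary_curve_Phi:
  assumes "stationary_curve \<alpha> I \<gamma>" and sp: "spacelike_curve I \<gamma>"
  shows "stationary_curve \<alpha> I (Phi \<circ> \<gamma>)"
proof -
  obtain J \<phi> N where cp: "change_of_parameter J I \<phi>"
    and al: "arclength_parametrized J (\<gamma> \<circ> \<phi>)"
    and un: "unit_normal_field J (\<gamma> \<circ> \<phi>) N"
    and eq: "\<And>s. s \<in> J \<Longrightarrow> curvature J (\<gamma> \<circ> \<phi>) N s =
           - \<alpha> * (lorentz (N s) ((\<gamma> \<circ> \<phi>) s) / \<bar>lorentz ((\<gamma> \<circ> \<phi>) s) ((\<gamma> \<circ> \<phi>) s)\<bar>)"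
    using assms(1) unfolding stationary_curve_def by blast
  have J: "nondegenerate_interval J" and im: "\<phi> ` J \<subseteq> I" and sm\<phi>: "smooth_on J \<phi>"
    using cp by (auto simp: change_of_parameter_def bij_betw_def)
  have sm: "smooth_on I \<gamma>"
    using sp by (simp add: spacelike_curve_def regular_curve_def)
  note d = twice_differentiable_compose_parameter[OF J im sm\<phi> sm]
  have v1: "vderiv J 1 (Phi \<circ> \<gamma> \<circ> \<phi>) s = Phi (vderiv J 1 (\<gamma> \<circ> \<phi>) s)"
    and v2: "vderiv J 2 (Phi \<circ> \<gamma> \<circ> \<phi>) s = Phi (vderiv J 2 (\<gamma> \<circ> \<phi>) s)" if "s \<in> J" for s
    unfolding comp_assoc
    by (rule vderiv_bounded_linear[OF bounded_linear_Phi J d that]; simp)+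
  have "arclength_parametrized J (Phi \<circ> \<gamma> \<circ> \<phi>)"
    using al v1 by (simp add: arclength_parametrized_def lorentz_Phi del: One_nat_def)
  moreover have "unit_normal_field J (Phi \<circ> \<gamma> \<circ> \<phi>) (Phi \<circ> N)"
    using un v1 smooth_on_bounded_linear[OF bounded_linear_Phi J, of N]
    by (simp add: unit_normal_field_def lorentz_Phi del: One_nat_def)
  moreover have "curvature J (Phi \<circ> \<gamma> \<circ> \<phi>) (Phi \<circ> N) s =
      - \<alpha> * (lorentz ((Phi \<circ> N) s) ((Phi \<circ> \<gamma> \<circ> \<phi>) s) /
        \<bar>lorentz ((Phi \<circ> \<gamma> \<circ> \<phi>) s) ((Phi \<circ> \<gamma> \<circ> \<phi>) s)\<bar>)" if "s \<in> J" for s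
    using eq[OF that] v2[OF that] by (simp add: curvature_def lorentz_Phi)
  moreover have "(Phi \<circ> \<gamma>) ` I \<inter> light_cone = {}"
    using assms(1) unfolding stationary_curve_def light_cone_def
    by (force simp: lorentz_Phi)
  ultimately show ?thesis
    using cp timelike_curve_Phi[OF sp] unfolding stationary_curve_def by blast
qed

theorem theorem3p1:
  fixes \<alpha> :: real and I :: "real set" and \<gamma> :: "real \<Rightarrow> L2"
  assumes "stationary_curve \<alpha> I \<gamma>" and "spacelike_curve I \<gamma>"
  shows "(\<gamma> ` I \<subseteq> cone_minus \<longrightarrow>
            stationary_curve \<alpha> I (Phi \<circ> \<gamma>) \<and> timelike_curve I (Phi \<circ> \<gamma>) \<and>
            (Phi \<circ> \<gamma>) ` I \<subseteq> cone_plus) \<and>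
         (\<gamma> ` I \<subseteq> cone_plus \<longrightarrow>
            stationary_curve \<alpha> I (Phi \<circ> \<gamma>) \<and> timelike_curve I (Phi \<circ> \<gamma>) \<and>
            (Phi \<circ> \<gamma>) ` I \<subseteq> cone_minus)"
  using stationary_curve_Phi[OF assms] timelike_curve_Phi[OF assms(2)]
  by (auto simp: cone_minus_def cone_plus_def lorentz_Phi image_subset_iff)

end
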